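(* Let $m\ge1$ and $b\ge2$ be integers. For each $b$-adic box $R\in\mathcal D_b^2$ with $|R|=b^{-(m-1)}$, choose a function $\phi_R\in\mathcal H_R$. Then: (i) $$\max_{x\in[0,1)^2}\ \sum_{R\in\mathcal D_b^2,\ |R|=b^{-(m-1)}}\phi_R(x)=m.$$ (ii) The set on which the maximum in (i) is achieved has the form $\mathcal P+[0,b^{-m})^2$, where $\mathcal P$ is a standard $(0,m,2)$-net in base $b$. (iii) Every standard $(0,m,2)$-net $\mathcal P$ in base $b$ may be obtained in this way: for every such $\mathcal P$ there exists a choice of $\phi_R\in\mathcal H_R$ (for all $R\in\mathcal D_b^2$ with $|R|=b^{-(m-1)}$) so that the set where $\sum_{|R|=b^{-(m-1)}}\phi_R$ attains its maximal value is precisely $\mathcal P+[0,b^{-m})^2$. (iv) The number of different standard $(0,m,2)$-nets in base $b$ is $(b!)^{mb^{m-1}}$.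
   Context: For an integer base $b\ge2$, $\mathcal D_b=\{[kb^{-j},(k+1)b^{-j}): j\in\{0,1,2,\dots\},\ k\in\{0,1,\dots,b^j-1\}\}$ is the system of $b$-adic subintervals of $[0,1)$, and $\mathcal D_b^2$ is the collection of $b$-adic boxes $R=R_1\times R_2$ with $R_1,R_2\in\mathcal D_b$; $|R|$ denotes area. A box $R\in\mathcal D_b^2$ of dimensions $b^{-m_1}\times b^{-m_2}$ is the union of a $b\times b$ array of $b$-adic boxes of dimensions $b^{-(m_1+1)}\times b^{-(m_2+1)}$ (its subboxes). The family $\mathcal H_R$ consists of all functions $\phi_R$ on $[0,1)^2$ such that: - $\phi_R$ takes values $\pm1$ on $R$ and vanishes outside $R$; - $\phi_R$ is constant on each of the $b$-adic subboxes of $R$ of dimensions $b^{-(m_1+1)}\times b^{-(m_2+1)}$; - in each row and in each column of this $b\times b$ array of subboxes there is exactly one subbox on which $\phi_R=+1$. A $(0,m,2)$-net in base $b$ is a set $\mathcal P\subset[0,1)^2$ of $b^m$ points such that every $b$-adic box of area $b^{-m}$ contains exactly one point of $\mathcal P$. It is called standard if all its points have coordinates of the form $kb^{-m}$ with $k\in\{0,1,\dots,b^m-1\}$. Nets are counted as sets. $A+B$ denotes the Minkowski sum. *)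

theory Defs
  imports "HOL-Analysis.Analysis" "HOL-Library.Set_Algebras"
begin

definition unit_square :: "(real \<times> real) set" where
  "unit_square = {0..<1} \<times> {0..<1}"

definition badic_interval :: "nat \<Rightarrow> nat \<Rightarrow> nat \<Rightarrow> real set" where
  "badic_interval b j k = {real k / real b ^ j ..< real (k + 1) / real b ^ j}"

definition badic_intervals :: "nat \<Rightarrow> real set set" where
  "badic_intervals b = {badic_interval b j k | j k. k < b ^ j}"

definition badic_boxes :: "nat \<Rightarrow> (real \<times> real) set set" where
  "badic_boxes b = {I \<times> J | I J. I \<in> badic_intervals b \<and> J \<in> badic_intervals b}"

abbreviation area :: "(real \<times> real) set \<Rightarrow> real" where
  "area R \<equiv> measure lborel R"

definition boxes_of_order :: "nat \<Rightarrow> nat \<Rightarrow> (real \<times> real) set set" where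
  "boxes_of_order b n = {R \<in> badic_boxes b. area R = 1 / real b ^ n}"

text \<open>The subbox in column \<open>i\<close> and row \<open>j\<close> (\<open>i, j < b\<close>) of the box
  \<open>badic_interval b m1 k1 \<times> badic_interval b m2 k2\<close>.\<close>

definition subbox :: "nat \<Rightarrow> nat \<Rightarrow> nat \<Rightarrow> nat \<Rightarrow> nat \<Rightarrow> nat \<Rightarrow> nat \<Rightarrow> (real \<times> real) set" where
  "subbox b m1 k1 m2 k2 i j =
     badic_interval b (m1 + 1) (b * k1 + i) \<times> badic_interval b (m2 + 1) (b * k2 + j)"

text \<open>For \<open>b \<ge> 2\<close> the parameters \<open>m1, k1, m2, k2\<close> are determined by the box \<open>R\<close>.
  Functions on the unit square are represented by their extension by zero to the plane.\<close>

definition haar_family :: "nat \<Rightarrow> (real \<times> real) set \<Rightarrow> (real \<times> real \<Rightarrow> real) set" where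
  "haar_family b R = {\<phi>. \<exists>m1 k1 m2 k2.
     k1 < b ^ m1 \<and> k2 < b ^ m2 \<and>
     R = badic_interval b m1 k1 \<times> badic_interval b m2 k2 \<and>
     (\<forall>x\<in>R. \<phi> x = 1 \<or> \<phi> x = -1) \<and>
     (\<forall>x. x \<notin> R \<longrightarrow> \<phi> x = 0) \<and>
     (\<forall>i<b. \<forall>j<b. \<phi> constant_on subbox b m1 k1 m2 k2 i j) \<and>
     (\<forall>j<b. \<exists>!i. i < b \<and> (\<forall>x\<in>subbox b m1 k1 m2 k2 i j. \<phi> x = 1)) \<and>
     (\<forall>i<b. \<exists>!j. j < b \<and> (\<forall>x\<in>subbox b m1 k1 m2 k2 i j. \<phi> x = 1))}"

definition haar_choice ::
    "nat \<Rightarrow> nat \<Rightarrow> ((real \<times> real) set \<Rightarrow> real \<times> real \<Rightarrow> real) \<Rightarrow> bool" where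
  "haar_choice b n \<phi> \<longleftrightarrow> (\<forall>R\<in>boxes_of_order b n. \<phi> R \<in> haar_family b R)"

definition haar_sum ::
    "nat \<Rightarrow> nat \<Rightarrow> ((real \<times> real) set \<Rightarrow> real \<times> real \<Rightarrow> real) \<Rightarrow> real \<times> real \<Rightarrow> real" where
  "haar_sum b n \<phi> x = (\<Sum>R\<in>boxes_of_order b n. \<phi> R x)"

definition max_set :: "(real \<times> real \<Rightarrow> real) \<Rightarrow> (real \<times> real) set" where
  "max_set f = {x. is_arg_max f (\<lambda>x. x \<in> unit_square) x}"

definition is_net :: "nat \<Rightarrow> nat \<Rightarrow> (real \<times> real) set \<Rightarrow> bool" where
  "is_net b m P \<longleftrightarrow> P \<subseteq> unit_square \<and> finite P \<and> card P = b ^ m \<and>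
     (\<forall>R\<in>boxes_of_order b m. \<exists>!p. p \<in> P \<inter> R)"

definition is_standard_net :: "nat \<Rightarrow> nat \<Rightarrow> (real \<times> real) set \<Rightarrow> bool" where
  "is_standard_net b m P \<longleftrightarrow> is_net b m P \<and>
     (\<forall>p\<in>P. \<exists>k<b ^ m. \<exists>l<b ^ m. p = (real k / real b ^ m, real l / real b ^ m))"

definition corner_square :: "nat \<Rightarrow> nat \<Rightarrow> (real \<times> real) set" where
  "corner_square b m = {0..<1 / real b ^ m} \<times> {0..<1 / real b ^ m}"

end

theory Submission
  imports Defs "HOL-Combinatorics.Permutations"
begin

text \<open>
  A function in the family of a box is a permutation of the \<open>b\<close> columns and rows of its
  subboxes. A point lies in exactly \<open>m\<close> boxes of area \<open>b\<^sup>1\<^sup>-\<^sup>m\<close>, one of each width \<open>b\<^sup>-\<^sup>s\<close>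
  (\<open>s < m\<close>), so the sum equals \<open>m\<close> iff all these permutations relate the digits of the two
  coordinates: the \<open>s\<close>-th relation expresses digit \<open>m - s\<close> of the ordinate through digit \<open>s + 1\<close>
  of the abscissa, given the first \<open>s\<close> digits of the abscissa and the first \<open>m - s - 1\<close> of the
  ordinate. Hence for solutions of all the relations the prefixes of lengths \<open>(s, m - s)\<close> and
  \<open>(s + 1, m - s - 1)\<close> determine each other, and the prefixes of any lengths \<open>(a, m - a)\<close>
  determine the solution. As each ordinate occurs, there are \<open>b\<^sup>m\<close> solutions, and they form a
  net. Conversely the points of a net in the columns of a box define its permutation, so that
  nets correspond bijectively to choices of permutations for the \<open>m b\<^sup>m\<^sup>-\<^sup>1\<close> boxes.
\<close>

section \<open>Nets on the grid of digits\<close>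

text \<open>The triple \<open>(s, u, v)\<close> encodes the box of width b^(-s) and height b^(s-n),
  hence of area b^(-n), at column \<open>u\<close> and row \<open>v\<close> among the boxes of its
  shape.\<close>

definition box_index :: "nat \<Rightarrow> nat \<Rightarrow> (nat \<times> nat \<times> nat) set" where
  "box_index b n = (SIGMA s:{..n}. {..<b ^ s} \<times> {..<b ^ (n - s)})"

lemma finite_box_index [simp]: "finite (box_index b n)"
  by (simp add: box_index_def)

lemma card_box_index: "card (box_index b n) = (n + 1) * b ^ n"
proof -
  have "card (box_index b n) = (\<Sum>s\<le>n. b ^ s * b ^ (n - s))"
    unfolding box_index_def by (subst card_SigmaI) (auto simp: card_cartesian_product)
  also have "\<dots> = (\<Sum>s\<le>n. b ^ n)"
    by (intro sum.cong) (auto simp flip: power_add)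
  finally show ?thesis by simp
qed

locale badic_grid =
  fixes b m :: nat
  assumes m_pos: "m \<ge> 1" and b_ge_2: "b \<ge> 2"
begin

lemma b_pos: "b > 0"
  using b_ge_2 by simp

text \<open>A cell \<open>(k, l)\<close> stands for the square of side \<open>b\<^sup>-\<^sup>m\<close> with lower left corner
  \<open>(k / b\<^sup>m, l / b\<^sup>m)\<close>. The pair \<open>prefix a (k, l)\<close> consists of the first \<open>a\<close> base-\<open>b\<close> digits of
  the abscissa and the first \<open>m - a\<close> digits of the ordinate: it locates the box of
  dimensions \<open>b\<^sup>-\<^sup>a \<times> b\<^sup>a\<^sup>-\<^sup>m\<close> containing the cell.\<close>

definition grid :: "(nat \<times> nat) set" where
  "grid = {..<b ^ m} \<times> {..<b ^ m}"

definition prefix :: "nat \<Rightarrow> nat \<times> nat \<Rightarrow> nat \<times> nat" where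
  "prefix a p = (fst p div b ^ (m - a), snd p div b ^ a)"

text \<open>Bijectivity of \<open>prefix a\<close> says that each box of dimensions b^(-a) x b^(a-m)
  contains exactly one cell of \<open>D\<close>; \<open>a = 0\<close> already gives b^m
  cells.\<close>

definition grid_net :: "(nat \<times> nat) set \<Rightarrow> bool" where
  "grid_net D \<longleftrightarrow> D \<subseteq> grid \<and>
     (\<forall>a\<le>m. bij_betw (prefix a) D ({..<b ^ a} \<times> {..<b ^ (m - a)}))"

text \<open>The extensional product makes systems that agree on all boxes equal, so that they can be
  counted.\<close>

definition perm_systems :: "(nat \<times> nat \<times> nat \<Rightarrow> nat \<Rightarrow> nat) set" where
  "perm_systems = (\<Pi>\<^sub>E i\<in>box_index b (m - 1). {\<tau>. \<tau> permutes {..<b}})"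

text \<open>The cell lies in a subbox of the box \<open>(s, u, v)\<close> at a position of the form
  \<open>(i, \<sigma> (s, u, v) i)\<close>, where \<open>(s, u, v)\<close> is the box of width \<open>b\<^sup>-\<^sup>s\<close> around the cell.\<close>

definition matches :: "(nat \<times> nat \<times> nat \<Rightarrow> nat \<Rightarrow> nat) \<Rightarrow> nat \<Rightarrow> nat \<times> nat \<Rightarrow> bool" where
  "matches \<sigma> s p \<longleftrightarrow>
     (snd p div b ^ s) mod b =
       \<sigma> (s, fst p div b ^ (m - s), snd p div b ^ Suc s) ((fst p div b ^ (m - Suc s)) mod b)"

definition good_cells :: "(nat \<times> nat \<times> nat \<Rightarrow> nat \<Rightarrow> nat) \<Rightarrow> (nat \<times> nat) set" where
  "good_cells \<sigma> = {p \<in> grid. \<forall>s<m. matches \<sigma> s p}"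

section \<open>Digits and prefixes of cells\<close>

lemma finite_grid [simp]: "finite grid"
  by (simp add: grid_def)

lemma div_power_less: "k < b ^ m \<Longrightarrow> a \<le> m \<Longrightarrow> k div b ^ (m - a) < b ^ a"
  by (rule less_mult_imp_div_less) (simp flip: power_add)

lemma div_power_less': "k < b ^ m \<Longrightarrow> a \<le> m \<Longrightarrow> k div b ^ a < b ^ (m - a)"
  by (rule less_mult_imp_div_less) (simp flip: power_add)

lemma div_power_Suc: "k div b ^ Suc s = k div b ^ s div b"
  by (metis div_mult2_eq mult.commute power_Suc)

lemma div_power_diff: "s < m \<Longrightarrow> k div b ^ (m - s) = k div b ^ (m - Suc s) div b"
  by (metis Suc_diff_Suc div_power_Suc)

lemma prefix_in: "p \<in> grid \<Longrightarrow> a \<le> m \<Longrightarrow> prefix a p \<in> {..<b ^ a} \<times> {..<b ^ (m - a)}"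
  by (auto simp: grid_def prefix_def div_power_less div_power_less')

lemma prefix_0: "p \<in> grid \<Longrightarrow> prefix 0 p = (0, snd p)"
  by (auto simp: grid_def prefix_def)

lemma prefix_m: "p \<in> grid \<Longrightarrow> prefix m p = (fst p, 0)"
  by (auto simp: grid_def prefix_def)

lemma parent_in_box_index:
  assumes "p \<in> grid" "s < m"
  shows "(s, fst p div b ^ (m - s), snd p div b ^ Suc s) \<in> box_index b (m - 1)"
  using assms div_power_less[of "fst p" s] div_power_less'[of "snd p" "Suc s"]
  by (auto simp: box_index_def grid_def)

lemma perm_systems_permutes:
  "\<sigma> \<in> perm_systems \<Longrightarrow> i \<in> box_index b (m - 1) \<Longrightarrow> \<sigma> i permutes {..<b}"
  unfolding perm_systems_def by (drule (1) PiE_mem) simp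

lemma card_perm_systems: "card perm_systems = fact b ^ (m * b ^ (m - 1))"
proof -
  have "card perm_systems = (\<Prod>i\<in>box_index b (m - 1). fact b)"
    unfolding perm_systems_def
    by (subst card_PiE) (auto simp: card_permutations[of "{..<b}" b])
  also have "\<dots> = fact b ^ (m * b ^ (m - 1))"
    using m_pos by (simp add: card_box_index)
  finally show ?thesis .
qed

text \<open>Both prefixes contain the coordinates of the same box \<open>(s, u, v)\<close>; one adds
  the row of the cell in that box, the other its column. The permutation of the box turns column
  into row, and its injectivity allows the way back.\<close>

lemma good_cells_prefix_Suc:
  assumes \<sigma>: "\<sigma> \<in> perm_systems" and p: "p \<in> good_cells \<sigma>" and q: "q \<in> good_cells \<sigma>"
    and s: "s < m"
  shows "prefix s p = prefix s q \<longleftrightarrow> prefix (Suc s) p = prefix (Suc s) q"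
proof -
  define K where "K p = fst p div b ^ (m - Suc s)" for p :: "nat \<times> nat"
  define L where "L p = snd p div b ^ s" for p :: "nat \<times> nat"
  have pre: "prefix s r = (K r div b, L r)" "prefix (Suc s) r = (K r, L r div b)" for r
    by (simp_all add: prefix_def K_def L_def div_power_diff[OF s] div_power_Suc del: power_Suc)
  have idx: "(s, K r div b, L r div b) \<in> box_index b (m - 1)"
    and mat: "L r mod b = \<sigma> (s, K r div b, L r div b) (K r mod b)" if "r \<in> good_cells \<sigma>" for r
    using that parent_in_box_index[of r s] s
    by (simp_all add: good_cells_def matches_def K_def L_def div_power_diff[OF s] div_power_Suc
          del: power_Suc)
  note inj = permutes_inj[OF perm_systems_permutes[OF \<sigma> idx[OF p]]]
  have "K p = K q" if "K p div b = K q div b" "L p = L q"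
    using mat[OF p] mat[OF q] that inj by (metis div_mod_decomp injD)
  moreover have "L p = L q" if "K p = K q" "L p div b = L q div b"
    using mat[OF p] mat[OF q] that by (metis div_mod_decomp)
  ultimately show ?thesis by (auto simp: pre)
qed

text \<open>Agreement at one level spreads to all levels, in particular to 0 and \<open>m\<close>,
  where the prefixes are the full ordinate and the full abscissa.\<close>

lemma good_cells_prefix_inj:
  assumes \<sigma>: "\<sigma> \<in> perm_systems" and a: "a \<le> m"
  shows "inj_on (prefix a) (good_cells \<sigma>)"
proof (rule inj_onI)
  fix p q assume p: "p \<in> good_cells \<sigma>" and q: "q \<in> good_cells \<sigma>" and eq: "prefix a p = prefix a q"
  have iff: "c \<le> m \<Longrightarrow> prefix c p = prefix c q \<longleftrightarrow> prefix 0 p = prefix 0 q" for c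
  proof (induction c)
    case (Suc c)
    then show ?case using good_cells_prefix_Suc[OF \<sigma> p q, of c] by simp
  qed simp
  have "prefix 0 p = prefix 0 q" "prefix m p = prefix m q"
    using iff[OF a] iff[of m] eq by simp_all
  moreover have "p \<in> grid" "q \<in> grid" using p q by (auto simp: good_cells_def)
  ultimately show "p = q" by (simp add: prefix_0 prefix_m prod_eq_iff)
qed

text \<open>The digits of the abscissa are determined one after the other, the leading one first.\<close>

lemma good_cell_with_ordinate:
  assumes \<sigma>: "\<sigma> \<in> perm_systems" and l: "l < b ^ m"
  shows "\<exists>k. (k, l) \<in> good_cells \<sigma>"
proof -
  \<comment> \<open>Here \<open>k\<close> consists of the first \<open>a\<close> digits of the
    abscissa, so \<open>a - s\<close> takes the place of \<open>m - s\<close> in the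
    relations.\<close>
  have "\<exists>k<b ^ a. \<forall>s<a. (l div b ^ s) mod b =
          \<sigma> (s, k div b ^ (a - s), l div b ^ Suc s) ((k div b ^ (a - Suc s)) mod b)"
    if "a \<le> m" for a
    using that
  proof (induction a)
    case (Suc a)
    then obtain k where k: "k < b ^ a" and IH: "\<And>s. s < a \<Longrightarrow> (l div b ^ s) mod b =
          \<sigma> (s, k div b ^ (a - s), l div b ^ Suc s) ((k div b ^ (a - Suc s)) mod b)"
      by auto
    \<comment> \<open>The digits found so far determine the box of width b^(-a); the next digit
      \<open>i\<close> is the preimage of the required ordinate digit under its permutation.\<close>
    let ?\<tau> = "\<sigma> (a, k, l div b ^ Suc a)"
    have "(a, k, l div b ^ Suc a) \<in> box_index b (m - 1)"
      using k Suc.prems div_power_less'[OF l, of "Suc a"] by (auto simp: box_index_def)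
    then have perm: "?\<tau> permutes {..<b}" by (rule perm_systems_permutes[OF \<sigma>])
    have "(l div b ^ a) mod b \<in> ?\<tau> ` {..<b}"
      using permutes_image[OF perm] b_pos by simp
    then obtain i where i: "i < b" "?\<tau> i = (l div b ^ a) mod b" by auto
    have less: "k * b + i < b ^ Suc a"
    proof -
      have "k * b + i < Suc k * b" using i by simp
      also have "\<dots> \<le> b ^ a * b" using k by (intro mult_right_mono) auto
      finally show ?thesis by (simp add: mult.commute)
    qed
    \<comment> \<open>Appending a last digit does not affect the leading ones, so the earlier
      relations persist.\<close>
    have down: "(k * b + i) div b ^ Suc c = k div b ^ c" for c
      using i by (simp add: div_mult2_eq)
    have "(l div b ^ s) mod b = \<sigma> (s, (k * b + i) div b ^ (Suc a - s), l div b ^ Suc s)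
        (((k * b + i) div b ^ (Suc a - Suc s)) mod b)" if "s < Suc a" for s
    proof (cases "s = a")
      case True
      then show ?thesis using i down[of 0] by simp
    next
      case False
      then have s: "s < a" using that by simp
      then have "Suc a - s = Suc (a - s)" "Suc a - Suc s = Suc (a - Suc s)" by auto
      then show ?thesis using IH[OF s] by (simp only: down)
    qed
    then show ?case using less by blast
  qed auto
  from this[of m] l show ?thesis by (auto simp: good_cells_def grid_def matches_def)
qed

text \<open>Pigeonhole: every ordinate occurs, so there are at least b^m good cells, and
  \<open>prefix a\<close> maps them injectively into a set of b^m elements.\<close>

lemma grid_net_good_cells:
  assumes \<sigma>: "\<sigma> \<in> perm_systems"
  shows "grid_net (good_cells \<sigma>)"
proof -
  have sub: "good_cells \<sigma> \<subseteq> grid" by (auto simp: good_cells_def)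
  then have fin: "finite (good_cells \<sigma>)" using finite_subset finite_grid by blast
  have "{..<b ^ m} \<subseteq> snd ` good_cells \<sigma>"
    using good_cell_with_ordinate[OF \<sigma>] by force
  then have card: "b ^ m \<le> card (good_cells \<sigma>)"
    by (metis card_image_le card_lessThan card_mono fin finite_imageI le_trans)
  have "prefix a ` good_cells \<sigma> = {..<b ^ a} \<times> {..<b ^ (m - a)}" if a: "a \<le> m" for a
  proof (rule card_subset_eq)
    show s: "prefix a ` good_cells \<sigma> \<subseteq> {..<b ^ a} \<times> {..<b ^ (m - a)}"
      using sub prefix_in a by blast
    have c: "card ({..<b ^ a} \<times> {..<b ^ (m - a)}) = b ^ m"
      using a by (simp add: card_cartesian_product flip: power_add)
    have "card (prefix a ` good_cells \<sigma>) \<le> card ({..<b ^ a} \<times> {..<b ^ (m - a)})"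
      by (intro card_mono s) auto
    then show "card (prefix a ` good_cells \<sigma>) = card ({..<b ^ a} \<times> {..<b ^ (m - a)})"
      using card card_image[OF good_cells_prefix_inj[OF \<sigma> a]] c by simp
  qed auto
  then show ?thesis
    using sub good_cells_prefix_inj[OF \<sigma>] by (auto simp: grid_net_def bij_betw_def)
qed

lemma card_grid_net:
  assumes "grid_net D"
  shows "card D = b ^ m"
proof -
  have "bij_betw (prefix 0) D ({..<b ^ 0} \<times> {..<b ^ (m - 0)})"
    using assms unfolding grid_net_def by blast
  from bij_betw_same_card[OF this] show ?thesis by (simp add: card_cartesian_product)
qed

text \<open>Both sets are nets and so have b^m cells; one inclusion suffices.\<close>

lemma good_cells_eqI:
  assumes "grid_net D" "\<sigma> \<in> perm_systems" "\<And>p s. p \<in> D \<Longrightarrow> s < m \<Longrightarrow> matches \<sigma> s p"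
  shows "good_cells \<sigma> = D"
proof -
  have "D \<subseteq> good_cells \<sigma>" using assms by (auto simp: good_cells_def grid_net_def)
  moreover have "finite (good_cells \<sigma>)"
    by (rule finite_subset[OF _ finite_grid]) (auto simp: good_cells_def)
  moreover have "card D = card (good_cells \<sigma>)"
    using assms grid_net_good_cells card_grid_net by simp
  ultimately show ?thesis using card_subset_eq by blast
qed

section \<open>The bijection between nets and systems of permutations\<close>

lemma child_less: "(s, u, v) \<in> box_index b (m - 1) \<Longrightarrow> i < b \<Longrightarrow> b * u + i < b ^ Suc s"
  using mult_le_mono2[of "Suc u" "b ^ s" b] by (auto simp: box_index_def)

text \<open>Column \<open>i\<close> of the box \<open>(s, u, v)\<close>, as a union of
  \<open>b\<close> subboxes, is itself a box of area b^(-m) and so is hit by the net.\<close>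

lemma grid_net_child:
  assumes D: "grid_net D" and idx: "(s, u, v) \<in> box_index b (m - 1)" and i: "i < b"
  obtains p where "p \<in> D" "prefix (Suc s) p = (b * u + i, v)" "s < m"
    "fst p div b ^ (m - s) = u" "(fst p div b ^ (m - Suc s)) mod b = i" "snd p div b ^ Suc s = v"
proof -
  have s: "s < m" and v: "v < b ^ (m - Suc s)"
    using idx m_pos by (auto simp: box_index_def)
  have "(b * u + i, v) \<in> prefix (Suc s) ` D"
    using D s v child_less[OF idx i] unfolding grid_net_def bij_betw_def
    by (metis Suc_leI lessThan_iff mem_Sigma_iff)
  then obtain p where p: "p \<in> D" "prefix (Suc s) p = (b * u + i, v)" by auto
  then have "fst p div b ^ (m - Suc s) = b * u + i" "snd p div b ^ Suc s = v"
    by (simp_all add: prefix_def)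
  moreover from this have "fst p div b ^ (m - s) = u"
    using div_power_diff[OF s, of "fst p"] i by simp
  ultimately show ?thesis using that p s i by simp
qed

text \<open>The value at \<open>i\<close> of the permutation of a box is the row of the good cell in
  column \<open>i\<close> of that box.\<close>

lemma good_cells_inj: "inj_on good_cells perm_systems"
proof (rule inj_onI)
  fix \<sigma> \<sigma>' assume \<sigma>: "\<sigma> \<in> perm_systems" and \<sigma>': "\<sigma>' \<in> perm_systems"
    and eq: "good_cells \<sigma> = good_cells \<sigma>'"
  show "\<sigma> = \<sigma>'"
  proof (rule PiE_ext)
    show "\<sigma> \<in> (\<Pi>\<^sub>E i\<in>box_index b (m - 1). {\<tau>. \<tau> permutes {..<b}})"
      "\<sigma>' \<in> (\<Pi>\<^sub>E i\<in>box_index b (m - 1). {\<tau>. \<tau> permutes {..<b}})"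
      using \<sigma> \<sigma>' by (simp_all add: perm_systems_def)
    fix idx assume idx: "idx \<in> box_index b (m - 1)"
    obtain s u v where suv: "idx = (s, u, v)" by (cases idx)
    show "\<sigma> idx = \<sigma>' idx"
    proof
      fix i show "\<sigma> idx i = \<sigma>' idx i"
      proof (cases "i < b")
        case True
        obtain p where p: "p \<in> good_cells \<sigma>" "s < m"
            "fst p div b ^ (m - s) = u" "(fst p div b ^ (m - Suc s)) mod b = i"
            "snd p div b ^ Suc s = v"
          using grid_net_child[OF grid_net_good_cells[OF \<sigma>] idx[unfolded suv] True] by metis
        then have "matches \<sigma> s p" "matches \<sigma>' s p" using eq by (auto simp: good_cells_def)
        then show ?thesis using p by (simp add: matches_def suv)
      next
        case False
        then show ?thesis
          using perm_systems_permutes[OF \<sigma> idx] perm_systems_permutes[OF \<sigma>' idx]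
          by (simp add: permutes_not_in)
      qed
    qed
  qed
qed

lemma grid_net_is_good_cells:
  assumes D: "grid_net D"
  shows "\<exists>\<sigma>\<in>perm_systems. good_cells \<sigma> = D"
proof -
  have inj: "inj_on (prefix a) D" if "a \<le> m" for a
    using D that by (auto simp: grid_net_def bij_betw_def)
  have grid: "p \<in> grid" if "p \<in> D" for p using D that by (auto simp: grid_net_def)
  have "\<exists>\<tau>. \<tau> permutes {..<b} \<and> (\<forall>p\<in>D. fst p div b ^ (m - s) = u \<longrightarrow> snd p div b ^ Suc s = v \<longrightarrow>
        (snd p div b ^ s) mod b = \<tau> ((fst p div b ^ (m - Suc s)) mod b))"
    if idx: "(s, u, v) \<in> box_index b (m - 1)" for s u v
  proof -
    have "\<forall>i. \<exists>p. i < b \<longrightarrow> p \<in> D \<and> prefix (Suc s) p = (b * u + i, v) \<and> s < m \<and>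
        fst p div b ^ (m - s) = u \<and> (fst p div b ^ (m - Suc s)) mod b = i \<and> snd p div b ^ Suc s = v"
      using grid_net_child[OF D idx] by metis
    \<comment> \<open>\<open>P i\<close> is the cell of \<open>D\<close> in column \<open>i\<close>
      of the box.\<close>
    then obtain P where P: "\<And>i. i < b \<Longrightarrow> P i \<in> D \<and> prefix (Suc s) (P i) = (b * u + i, v) \<and> s < m \<and>
        fst (P i) div b ^ (m - s) = u \<and> (fst (P i) div b ^ (m - Suc s)) mod b = i \<and>
        snd (P i) div b ^ Suc s = v" by metis
    have s: "s < m" using P b_pos by blast
    \<comment> \<open>The row of \<open>P i\<close> within the box; the identity beyond
      \<open>b\<close>, as \<open>permutes\<close> demands.\<close>
    define \<tau> where "\<tau> i = (if i < b then (snd (P i) div b ^ s) mod b else i)" for i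
    have "inj_on \<tau> {..<b}"
    proof (rule inj_onI)
      fix i j assume "i \<in> {..<b}" "j \<in> {..<b}" and eq: "\<tau> i = \<tau> j"
      then have i: "i < b" and j: "j < b" by auto
      \<comment> \<open>Equal values of \<open>\<tau>\<close> put both cells into the same row of
        the box. That row is a box of area b^(-m), so it contains only one cell of
        \<open>D\<close>.\<close>
      have "snd (P i) div b ^ s = snd (P j) div b ^ s"
        using P[OF i] P[OF j] eq i j unfolding \<tau>_def div_power_Suc by (metis div_mod_decomp)
      then have "prefix s (P i) = prefix s (P j)"
        using P[OF i] P[OF j] by (simp add: prefix_def)
      then have "P i = P j" using inj[of s] s P[OF i] P[OF j] by (simp add: inj_on_def)
      then show "i = j" using P[OF i] P[OF j] by metis
    qed
    moreover have "\<tau> ` {..<b} \<subseteq> {..<b}" using b_pos by (auto simp: \<tau>_def)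
    ultimately have "bij_betw \<tau> {..<b} {..<b}"
      by (simp add: bij_betw_def endo_inj_surj)
    then have "\<tau> permutes {..<b}" by (rule bij_imp_permutes) (simp add: \<tau>_def)
    moreover have "(snd p div b ^ s) mod b = \<tau> ((fst p div b ^ (m - Suc s)) mod b)"
      if p: "p \<in> D" "fst p div b ^ (m - s) = u" "snd p div b ^ Suc s = v" for p
    proof -
      define i where "i = (fst p div b ^ (m - Suc s)) mod b"
      have i: "i < b" using b_pos by (simp add: i_def)
      have "fst p div b ^ (m - Suc s) = b * u + i"
        using p(2) unfolding div_power_diff[OF s] i_def by (metis div_mult_mod_eq mult.commute)
      \<comment> \<open>The cells \<open>p\<close> and \<open>P i\<close> share column
        \<open>i\<close> of the box, which contains only one cell of \<open>D\<close>.\<close>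
      then have "prefix (Suc s) p = prefix (Suc s) (P i)"
        using P[OF i] p by (simp add: prefix_def)
      then have "p = P i" using inj[of "Suc s"] s P[OF i] p by (simp add: inj_on_def)
      then show ?thesis using i unfolding i_def[symmetric] by (simp add: \<tau>_def)
    qed
    ultimately show ?thesis by blast
  qed
  then have "\<forall>idx. \<exists>\<tau>. idx \<in> box_index b (m - 1) \<longrightarrow> \<tau> permutes {..<b} \<and>
      (\<forall>p\<in>D. fst p div b ^ (m - fst idx) = fst (snd idx) \<longrightarrow>
         snd p div b ^ Suc (fst idx) = snd (snd idx) \<longrightarrow>
         (snd p div b ^ fst idx) mod b = \<tau> ((fst p div b ^ (m - Suc (fst idx))) mod b))"
    by (metis prod.collapse)
  then obtain f where f: "\<And>idx. idx \<in> box_index b (m - 1) \<Longrightarrow> f idx permutes {..<b} \<and>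
      (\<forall>p\<in>D. fst p div b ^ (m - fst idx) = fst (snd idx) \<longrightarrow>
         snd p div b ^ Suc (fst idx) = snd (snd idx) \<longrightarrow>
         (snd p div b ^ fst idx) mod b = f idx ((fst p div b ^ (m - Suc (fst idx))) mod b))"
    by metis
  define \<sigma> where "\<sigma> = restrict f (box_index b (m - 1))"
  have \<sigma>: "\<sigma> \<in> perm_systems" using f by (auto simp: \<sigma>_def perm_systems_def)
  have "matches \<sigma> s p" if "p \<in> D" "s < m" for p s
    using f[OF parent_in_box_index[OF grid[OF that(1)] that(2)]] that
      parent_in_box_index[OF grid[OF that(1)] that(2)]
    by (simp add: matches_def \<sigma>_def)
  then show ?thesis using good_cells_eqI[OF D \<sigma>] \<sigma> by blast
qed

lemma card_grid_nets: "card {D. grid_net D} = fact b ^ (m * b ^ (m - 1))"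
proof -
  have "{D. grid_net D} = good_cells ` perm_systems"
    using grid_net_good_cells grid_net_is_good_cells by blast
  then show ?thesis using card_image[OF good_cells_inj] card_perm_systems by simp
qed

end

section \<open>Boxes, cells and Haar functions\<close>

definition badic_box :: "nat \<Rightarrow> nat \<Rightarrow> nat \<times> nat \<times> nat \<Rightarrow> (real \<times> real) set" where
  "badic_box b n i =
     badic_interval b (fst i) (fst (snd i)) \<times> badic_interval b (n - fst i) (snd (snd i))"

lemma badic_interval_eq_iff:
  assumes "b \<ge> 2"
  shows "badic_interval b j k = badic_interval b j' k' \<longleftrightarrow> j = j' \<and> k = k'"
proof
  assume eq: "badic_interval b j k = badic_interval b j' k'"
  have "real k / real b ^ j < real (k + 1) / real b ^ j" for j k
    using assms by (simp add: divide_strict_right_mono)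
  then have ends: "real k / real b ^ j = real k' / real b ^ j'"
      "real (k + 1) / real b ^ j = real (k' + 1) / real b ^ j'"
    using eq by (auto simp: badic_interval_def atLeastLessThan_eq_iff)
  \<comment> \<open>The difference of the two ends is the length, which determines the
    exponent.\<close>
  then have "1 / real b ^ j = 1 / real b ^ j'" by (simp add: add_divide_distrib)
  then have "real b ^ j = real b ^ j'" by simp
  then have "j = j'" using assms by (simp add: power_inject_exp)
  then show "j = j' \<and> k = k'" using ends assms by simp
qed auto

lemma badic_interval_nonempty: "b > 0 \<Longrightarrow> badic_interval b j k \<noteq> {}"
  by (simp add: badic_interval_def divide_strict_right_mono)

text \<open>Uniqueness of the parameters of a box, which eliminates the existential quantifiers in
  \<open>haar_family\<close>.\<close>

lemma badic_box_eq_iff: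
  assumes "b \<ge> 2"
  shows "badic_interval b j k \<times> badic_interval b j' k' = badic_interval b i l \<times> badic_interval b i' l'
    \<longleftrightarrow> j = i \<and> k = l \<and> j' = i' \<and> k' = l'"
  using assms badic_interval_nonempty[of b] by (auto simp: times_eq_iff badic_interval_eq_iff)

lemma area_badic_box:
  assumes "b > 0"
  shows "area (badic_interval b j k \<times> badic_interval b j' k') = 1 / real b ^ (j + j')"
proof -
  have len: "emeasure lborel (badic_interval b j k) = ennreal (1 / real b ^ j)" for j k
    using assms unfolding badic_interval_def
    by (subst emeasure_lborel_Ico) (auto simp: divide_right_mono add_divide_distrib)
  have "emeasure lborel (badic_interval b j k \<times> badic_interval b j' k') =
      ennreal (1 / real b ^ j) * ennreal (1 / real b ^ j')"
    unfolding lborel_prod[symmetric]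
    by (subst lborel.emeasure_pair_measure_Times) (auto simp: len, auto simp: badic_interval_def)
  then show ?thesis
    using assms by (simp add: measure_def power_add flip: ennreal_mult)
qed

text \<open>The area fixes the sum of the two exponents, so the width exponent alone determines the
  shape.\<close>

lemma boxes_of_order_eq:
  assumes "b \<ge> 2"
  shows "boxes_of_order b n = badic_box b n ` box_index b n"
proof (intro equalityI subsetI)
  fix R assume "R \<in> boxes_of_order b n"
  then obtain j k j' k' where R: "R = badic_interval b j k \<times> badic_interval b j' k'"
      "k < b ^ j" "k' < b ^ j'" and "area R = 1 / real b ^ n"
    by (auto simp: boxes_of_order_def badic_boxes_def badic_intervals_def)
  then have "real b ^ (j + j') = real b ^ n" using area_badic_box[of b] assms by simp
  then have "j + j' = n" using assms by (simp add: power_inject_exp)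
  then show "R \<in> badic_box b n ` box_index b n"
    using R by (intro image_eqI[of _ _ "(j, k, k')"]) (auto simp: badic_box_def box_index_def)
next
  fix R assume "R \<in> badic_box b n ` box_index b n"
  then show "R \<in> boxes_of_order b n"
    using assms area_badic_box[of b]
    by (auto simp: boxes_of_order_def badic_boxes_def badic_intervals_def badic_box_def
          box_index_def) blast
qed

lemma inj_on_badic_box: "b \<ge> 2 \<Longrightarrow> inj_on (badic_box b n) (box_index b n)"
  by (auto simp: inj_on_def badic_box_def badic_box_eq_iff)

lemma le_nat_floor_iff: "0 \<le> y \<Longrightarrow> c \<le> nat \<lfloor>y\<rfloor> \<longleftrightarrow> real c \<le> y"
  by (simp add: le_nat_iff le_floor_iff)

text \<open>Rounding down to the mesh b^(-m) yields \<open>m\<close> digits for a point of [0,1),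
  and the division drops the last \<open>m - j\<close> of them. The condition
  \<open>0 \<le> x\<close> is stated separately because \<open>nat\<close> sends negative integers
  to 0.\<close>

lemma mem_badic_interval_iff:
  assumes "b > 0" "j \<le> m"
  shows "x \<in> badic_interval b j k \<longleftrightarrow> 0 \<le> x \<and> nat \<lfloor>real b ^ m * x\<rfloor> div b ^ (m - j) = k"
proof (cases "0 \<le> x")
  case True
  let ?n = "nat \<lfloor>real b ^ m * x\<rfloor>" and ?M = "b ^ (m - j)"
  have M: "?M > 0" using assms by simp
  have split: "real b ^ m = real b ^ j * real ?M" using assms by (simp flip: power_add)
  have le: "c \<le> ?n div ?M \<longleftrightarrow> real c / real b ^ j \<le> x" for c
  proof -
    have "c \<le> ?n div ?M \<longleftrightarrow> c * ?M \<le> ?n" using M by (simp add: less_eq_div_iff_mult_less_eq)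
    also have "\<dots> \<longleftrightarrow> real c * real ?M \<le> real b ^ m * x"
      using True by (subst le_nat_floor_iff) simp_all
    also have "\<dots> \<longleftrightarrow> real c * real ?M \<le> (real b ^ j * x) * real ?M"
      unfolding split by (simp add: ac_simps)
    also have "\<dots> \<longleftrightarrow> real c \<le> real b ^ j * x" using M by (subst mult_le_cancel_right_pos) simp_all
    also have "\<dots> \<longleftrightarrow> real c / real b ^ j \<le> x" using assms by (simp add: field_simps)
    finally show ?thesis .
  qed
  \<comment> \<open>An equation of naturals as two threshold conditions, which \<open>le\<close>
    turns into the two ends of the interval.\<close>
  have "?n div ?M = k \<longleftrightarrow> k \<le> ?n div ?M \<and> \<not> k + 1 \<le> ?n div ?M" by linarith
  then show ?thesis unfolding le badic_interval_def using True by auto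
next
  case False
  moreover have "0 \<le> real k / real b ^ j" by simp
  ultimately show ?thesis unfolding badic_interval_def by (meson atLeastLessThan_iff order_trans)
qed

lemma ex1_image_iff:
  assumes "inj f"
  shows "(\<exists>!y. y \<in> f ` A) \<longleftrightarrow> (\<exists>!x. x \<in> A)"
proof
  assume "\<exists>!y. y \<in> f ` A"
  then obtain x where x: "x \<in> A" "\<And>y. y \<in> f ` A \<Longrightarrow> y = f x" by auto
  then show "\<exists>!x. x \<in> A" using injD[OF assms] by (intro ex1I[of _ x]) blast+
qed auto

section \<open>Passage between the grid of cells and the unit square\<close>

context badic_grid
begin

definition cell :: "real \<times> real \<Rightarrow> nat \<times> nat" where
  "cell x = (nat \<lfloor>real b ^ m * fst x\<rfloor>, nat \<lfloor>real b ^ m * snd x\<rfloor>)"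

definition corner :: "nat \<times> nat \<Rightarrow> real \<times> real" where
  "corner p = (real (fst p) / real b ^ m, real (snd p) / real b ^ m)"

lemma corner_in_unit_square: "p \<in> grid \<Longrightarrow> corner p \<in> unit_square"
  using b_pos by (auto simp: grid_def corner_def unit_square_def simp flip: of_nat_power)

lemma cell_in_grid:
  assumes "x \<in> unit_square"
  shows "cell x \<in> grid"
proof -
  have "nat \<lfloor>real b ^ m * y\<rfloor> < b ^ m" if "0 \<le> y" "y < 1" for y
  proof -
    have "real b ^ m * y < real (b ^ m)" using that b_pos by simp
    then show ?thesis using that le_nat_floor_iff[of "real b ^ m * y" "b ^ m"] by simp
  qed
  then show ?thesis using assms by (auto simp: cell_def grid_def unit_square_def)
qed

lemma cell_corner: "cell (corner p) = p"
  using b_pos by (simp add: cell_def corner_def)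

lemma inj_corner: "inj corner"
  by (metis cell_corner injI)

text \<open>The translates of the corner square by the corners tile the unit square, and
  \<open>cell\<close> tells in which tile a point lies.\<close>

lemma corner_plus_corner_square:
  assumes "D \<subseteq> grid"
  shows "corner ` D + corner_square b m = {x \<in> unit_square. cell x \<in> D}"
proof -
  define N where "N = real b ^ m"
  have N: "N > 0" using b_pos by (simp add: N_def)
  have fl: "nat \<lfloor>N * y\<rfloor> = k \<longleftrightarrow> y - real k / N \<in> {0..<1 / N}" if "0 \<le> y" for y k
  proof -
    have "nat \<lfloor>N * y\<rfloor> = k \<longleftrightarrow> k \<le> nat \<lfloor>N * y\<rfloor> \<and> \<not> k + 1 \<le> nat \<lfloor>N * y\<rfloor>" by linarith
    also have "\<dots> \<longleftrightarrow> real k \<le> N * y \<and> N * y < real k + 1"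
      using that N by (subst (1 2) le_nat_floor_iff) auto
    also have "\<dots> \<longleftrightarrow> y - real k / N \<in> {0..<1 / N}" using N by (simp add: diff_less_eq pos_le_divide_eq pos_divide_le_eq pos_less_divide_eq mult.commute
          add.commute flip: add_divide_distrib)
    finally show ?thesis .
  qed
  \<comment> \<open>Since \<open>k + 1 \<le> N\<close> for integers, the translated squares stay
    inside the unit square.\<close>
  have less1: "real k / N + t < 1" if "k < b ^ m" "t < 1 / N" for k t
  proof -
    have "real k + 1 \<le> N" using that(1) unfolding N_def by (simp flip: of_nat_power)
    then have "real k / N + 1 / N \<le> 1" using N by (simp flip: add_divide_distrib)
    then show ?thesis using that by simp
  qed
  show ?thesis
  proof (intro equalityI subsetI)
    fix x assume "x \<in> corner ` D + corner_square b m"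
    then obtain p c where p: "p \<in> D" and c: "c \<in> corner_square b m" and x: "x = corner p + c"
      unfolding set_plus_def by blast
    have pg: "fst p < b ^ m" "snd p < b ^ m" using p assms by (auto simp: grid_def)
    have c': "fst c \<in> {0..<1 / N}" "snd c \<in> {0..<1 / N}"
      using c by (auto simp: corner_square_def N_def)
    have x': "fst x = real (fst p) / N + fst c" "snd x = real (snd p) / N + snd c"
      by (simp_all add: x corner_def N_def)
    have nonneg: "0 \<le> fst x" "0 \<le> snd x" using c' N by (auto simp: x')
    have "cell x = p"
      using fl[OF nonneg(1)] fl[OF nonneg(2)] c' unfolding cell_def N_def[symmetric]
      by (simp add: x' prod_eq_iff)
    moreover have "x \<in> unit_square"
      using nonneg less1[OF pg(1)] less1[OF pg(2)] c' by (simp add: unit_square_def mem_Times_iff x')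
    ultimately show "x \<in> {x \<in> unit_square. cell x \<in> D}" using p by simp
  next
    fix x assume "x \<in> {x \<in> unit_square. cell x \<in> D}"
    then have x: "x \<in> unit_square" "cell x \<in> D" by auto
    have "x - corner (cell x) \<in> corner_square b m"
      using x(1) fl[of "fst x" "fst (cell x)"] fl[of "snd x" "snd (cell x)"]
      by (auto simp: unit_square_def corner_square_def corner_def cell_def N_def mem_Times_iff)
    then show "x \<in> corner ` D + corner_square b m"
      using x unfolding set_plus_def by (force intro: bexI[of _ "x - corner (cell x)"])
  qed
qed

lemma mem_badic_box_m_iff:
  "a \<le> m \<Longrightarrow> x \<in> badic_box b m (a, u, v) \<longleftrightarrow> 0 \<le> fst x \<and> 0 \<le> snd x \<and> prefix a (cell x) = (u, v)"
  using b_pos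
  by (auto simp: badic_box_def mem_Times_iff mem_badic_interval_iff[where m = m] prefix_def cell_def)

text \<open>A corner lies in the box \<open>(a, u, v)\<close> iff the prefix of its cell at level
  \<open>a\<close> is \<open>(u, v)\<close>; unique points in boxes thus mean unique preimages of
  prefixes.\<close>

lemma is_net_corner_iff:
  assumes D: "D \<subseteq> grid"
  shows "is_net b m (corner ` D) \<longleftrightarrow> grid_net D"
proof -
  have hit: "(\<exists>!p. p \<in> corner ` D \<inter> badic_box b m (a, u, v)) \<longleftrightarrow> (\<exists>!q. q \<in> D \<and> prefix a q = (u, v))"
    if a: "a \<le> m" for a u v
  proof -
    have "corner ` D \<inter> badic_box b m (a, u, v) = corner ` {q \<in> D. prefix a q = (u, v)}"
      by (auto simp: mem_badic_box_m_iff[OF a] cell_corner) (auto simp: corner_def)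
    then show ?thesis using ex1_image_iff[OF inj_corner] by simp
  qed
  have bij: "bij_betw (prefix a) D X \<longleftrightarrow> (\<forall>y\<in>X. \<exists>!q. q \<in> D \<and> prefix a q = y)"
    if "a \<le> m" and X: "X = {..<b ^ a} \<times> {..<b ^ (m - a)}" for a X
  proof
    assume "bij_betw (prefix a) D X"
    then show "\<forall>y\<in>X. \<exists>!q. q \<in> D \<and> prefix a q = y"
      unfolding bij_betw_def inj_on_def by blast
  next
    assume *: "\<forall>y\<in>X. \<exists>!q. q \<in> D \<and> prefix a q = y"
    have "prefix a q \<in> X" if "q \<in> D" for q
      using prefix_in[of q a] that D \<open>a \<le> m\<close> unfolding X by blast
    with * show "bij_betw (prefix a) D X"
      by (intro bij_betwI') metis+
  qed
  have "(\<forall>R\<in>boxes_of_order b m. \<exists>!p. p \<in> corner ` D \<inter> R) \<longleftrightarrow>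
      (\<forall>a\<le>m. \<forall>y\<in>{..<b ^ a} \<times> {..<b ^ (m - a)}. \<exists>!q. q \<in> D \<and> prefix a q = y)"
    unfolding boxes_of_order_eq[OF b_ge_2] box_index_def using hit by (simp, simp add: Ball_def)
  also have "\<dots> \<longleftrightarrow> grid_net D"
    using D bij by (auto simp: grid_net_def)
  finally have "(\<forall>R\<in>boxes_of_order b m. \<exists>!p. p \<in> corner ` D \<inter> R) \<longleftrightarrow> grid_net D" .
  moreover have "corner ` D \<subseteq> unit_square" using D corner_in_unit_square by blast
  moreover have "finite D" using D finite_grid finite_subset by blast
  moreover have "card (corner ` D) = card D" using inj_corner by (metis card_image inj_on_subset subset_UNIV)
  ultimately show ?thesis using card_grid_net[of D] by (auto simp: is_net_def)
qed

lemma is_standard_net_iff: "is_standard_net b m P \<longleftrightarrow> (\<exists>D. grid_net D \<and> P = corner ` D)"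
proof
  assume P: "is_standard_net b m P"
  define D where "D = {p \<in> grid. corner p \<in> P}"
  have "P = corner ` D"
  proof (intro equalityI subsetI)
    fix p assume p: "p \<in> P"
    then obtain k l where "k < b ^ m" "l < b ^ m" "p = corner (k, l)"
      using P by (auto simp: is_standard_net_def corner_def)
    then show "p \<in> corner ` D" using p by (auto simp: D_def grid_def)
  qed (auto simp: D_def)
  moreover have "D \<subseteq> grid" by (auto simp: D_def)
  ultimately show "\<exists>D. grid_net D \<and> P = corner ` D"
    using P is_net_corner_iff[of D] by (auto simp: is_standard_net_def)
next
  assume "\<exists>D. grid_net D \<and> P = corner ` D"
  then obtain D where D: "grid_net D" "P = corner ` D" by auto
  then have "D \<subseteq> grid" by (simp add: grid_net_def)
  then show "is_standard_net b m P"
    using is_net_corner_iff[of D] D unfolding is_standard_net_def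
    by (force simp: corner_def grid_def)
qed

lemma card_standard_nets: "card {P. is_standard_net b m P} = fact b ^ (m * b ^ (m - 1))"
proof -
  have "{P. is_standard_net b m P} = (`) corner ` {D. grid_net D}"
    by (auto simp: is_standard_net_iff)
  moreover have "inj_on ((`) corner) {D. grid_net D}"
    using inj_corner by (simp add: inj_on_def inj_image_eq_iff)
  ultimately show ?thesis by (simp add: card_image card_grid_nets)
qed

section \<open>Haar functions as permutations\<close>

definition codes ::
    "((real \<times> real) set \<Rightarrow> real \<times> real \<Rightarrow> real) \<Rightarrow> (nat \<times> nat \<times> nat \<Rightarrow> nat \<Rightarrow> nat) \<Rightarrow> bool" where
  "codes \<phi> \<sigma> \<longleftrightarrow> (\<forall>i\<in>box_index b (m - 1). \<forall>x. \<phi> (badic_box b (m - 1) i) x =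
     (if x \<in> badic_box b (m - 1) i then if matches \<sigma> (fst i) (cell x) then 1 else -1 else 0))"

lemma codesD:
  "codes \<phi> \<sigma> \<Longrightarrow> i \<in> box_index b (m - 1) \<Longrightarrow> \<phi> (badic_box b (m - 1) i) x =
     (if x \<in> badic_box b (m - 1) i then if matches \<sigma> (fst i) (cell x) then 1 else -1 else 0)"
  unfolding codes_def by blast

lemma mem_badic_box_iff:
  assumes "s < m"
  shows "x \<in> badic_box b (m - 1) (s, u, v) \<longleftrightarrow> 0 \<le> fst x \<and> 0 \<le> snd x \<and>
    fst (cell x) div b ^ (m - s) = u \<and> snd (cell x) div b ^ Suc s = v"
proof -
  \<comment> \<open>Height b^(s+1-m) fixes \<open>m - 1 - s\<close> digits of the ordinate, so
    \<open>s + 1\<close> of its \<open>m\<close> digits are dropped.\<close>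
  have "m - (m - 1 - s) = Suc s" using assms by simp
  then show ?thesis
    using assms b_pos
    by (auto simp: badic_box_def mem_Times_iff mem_badic_interval_iff[where m = m] cell_def
          simp del: power_Suc)
qed

lemma mem_subbox_iff:
  assumes "s < m"
  shows "x \<in> subbox b s u (m - 1 - s) v i j \<longleftrightarrow> 0 \<le> fst x \<and> 0 \<le> snd x \<and>
    fst (cell x) div b ^ (m - Suc s) = b * u + i \<and> snd (cell x) div b ^ s = b * v + j"
proof -
  have "m - (m - 1 - s + 1) = s" using assms by simp
  then show ?thesis
    using assms b_pos
    by (auto simp: subbox_def mem_Times_iff mem_badic_interval_iff[where m = m] cell_def)
qed

text \<open>The positions of the values +1 form a permutation matrix; \<open>\<tau>\<close> sends
  each column to the row of its +1, and all other subboxes carry -1.\<close>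

lemma haar_family_iff:
  assumes idx: "(s, u, v) \<in> box_index b (m - 1)"
  shows "f \<in> haar_family b (badic_box b (m - 1) (s, u, v)) \<longleftrightarrow>
    (\<exists>\<tau>. \<tau> permutes {..<b} \<and> (\<forall>x. f x = (if x \<in> badic_box b (m - 1) (s, u, v)
       then if (snd (cell x) div b ^ s) mod b = \<tau> ((fst (cell x) div b ^ (m - Suc s)) mod b)
       then 1 else -1 else 0)))"
    (is "f \<in> haar_family b ?R \<longleftrightarrow> ?rhs")
proof -
  \<comment> \<open>The quotients of \<open>K x\<close> and \<open>L x\<close> by \<open>b\<close>
    locate the box, their last digits the subbox inside it.\<close>
  define K where "K x = fst (cell x) div b ^ (m - Suc s)" for x
  define L where "L x = snd (cell x) div b ^ s" for x
  define S where "S = subbox b s u (m - 1 - s) v"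
  have s: "s < m" and uv: "u < b ^ s" "v < b ^ (m - 1 - s)"
    using idx m_pos by (auto simp: box_index_def)
  have memR: "x \<in> ?R \<longleftrightarrow> 0 \<le> fst x \<and> 0 \<le> snd x \<and> K x div b = u \<and> L x div b = v" for x
    unfolding mem_badic_box_iff[OF s] K_def L_def div_power_diff[OF s] div_power_Suc ..
  have memS: "x \<in> S i j \<longleftrightarrow> x \<in> ?R \<and> K x mod b = i \<and> L x mod b = j" if "i < b" "j < b" for x i j
  proof -
    have "k = b * w + i \<longleftrightarrow> k div b = w \<and> k mod b = i" if "i < b" for k w i
      using that by auto
    then show ?thesis unfolding memR S_def mem_subbox_iff[OF s] K_def L_def using that by auto
  qed
  \<comment> \<open>On an empty subbox the condition \<open>f x = 1\<close> would hold
    vacuously.\<close>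
  have ne: "\<exists>x. x \<in> S i j" for i j
    using badic_interval_nonempty[OF b_pos] by (auto simp: S_def subbox_def)
  have fam: "f \<in> haar_family b ?R \<longleftrightarrow>
     (\<forall>x\<in>?R. f x = 1 \<or> f x = -1) \<and> (\<forall>x. x \<notin> ?R \<longrightarrow> f x = 0) \<and>
     (\<forall>i<b. \<forall>j<b. f constant_on S i j) \<and>
     (\<forall>j<b. \<exists>!i. i < b \<and> (\<forall>x\<in>S i j. f x = 1)) \<and>
     (\<forall>i<b. \<exists>!j. j < b \<and> (\<forall>x\<in>S i j. f x = 1))"
    using uv by (auto simp: haar_family_def badic_box_def badic_box_eq_iff[OF b_ge_2] S_def)
  show ?thesis
  proof
    assume f: "f \<in> haar_family b ?R"
    note vals = f[unfolded fam, THEN conjunct1]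
      and out = f[unfolded fam, THEN conjunct2, THEN conjunct1]
      and const = f[unfolded fam, THEN conjunct2, THEN conjunct2, THEN conjunct1]
      and rows = f[unfolded fam, THEN conjunct2, THEN conjunct2, THEN conjunct2, THEN conjunct1]
      and cols = f[unfolded fam, THEN conjunct2, THEN conjunct2, THEN conjunct2, THEN conjunct2]
    define \<tau> where "\<tau> i = (if i < b then THE j. j < b \<and> (\<forall>x\<in>S i j. f x = 1) else i)" for i
    have \<tau>: "\<tau> i < b \<and> (\<forall>x\<in>S i (\<tau> i). f x = 1)" if "i < b" for i
      using theI'[OF cols[rule_format, OF that]] that by (simp add: \<tau>_def)
    have "inj_on \<tau> {..<b}"
    proof (rule inj_onI)
      fix i i' assume "i \<in> {..<b}" "i' \<in> {..<b}" and eq: "\<tau> i = \<tau> i'"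
      then have ii: "i < b" "i' < b" by auto
      \<comment> \<open>The column condition defines \<open>\<tau>\<close>; the row condition makes
        it injective.\<close>
      have "\<exists>!i. i < b \<and> (\<forall>x\<in>S i (\<tau> i'). f x = 1)"
        using rows \<tau>[OF ii(2)] by simp
      then show "i = i'" using \<tau>[OF ii(1)] \<tau>[OF ii(2)] ii eq by metis
    qed
    moreover have "\<tau> ` {..<b} \<subseteq> {..<b}" using \<tau> by auto
    ultimately have "bij_betw \<tau> {..<b} {..<b}" by (simp add: bij_betw_def endo_inj_surj)
    then have perm: "\<tau> permutes {..<b}" by (rule bij_imp_permutes) (simp add: \<tau>_def)
    have val: "f x = (if L x mod b = \<tau> (K x mod b) then 1 else -1)" if x: "x \<in> ?R" for x
    proof -
      have less: "K x mod b < b" "L x mod b < b" using b_pos by auto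
      have xS: "x \<in> S (K x mod b) (L x mod b)" using memS[OF less] x by simp
      show ?thesis
      proof (cases "f x = 1")
        case True
        \<comment> \<open>Constancy spreads the value 1 from \<open>x\<close> to its whole subbox,
          which must then be the unique one of its column.\<close>
        then have "\<forall>y\<in>S (K x mod b) (L x mod b). f y = 1"
          using const[rule_format, OF less] xS unfolding constant_on_def by metis
        then have "L x mod b = \<tau> (K x mod b)"
          using cols[rule_format, OF less(1)] \<tau>[OF less(1)] less(2) by (blast elim: ex1E)
        then show ?thesis using True by simp
      next
        case False
        then have "L x mod b \<noteq> \<tau> (K x mod b)" using \<tau>[OF less(1)] xS by auto
        moreover have "f x = 1 \<or> f x = -1" using vals x by blast
        ultimately show ?thesis using False by simp
      qed
    qed
    show ?rhs
      unfolding K_def[symmetric] L_def[symmetric] using perm val out by (intro exI[of _ \<tau>]) simp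
  next
    assume ?rhs
    then obtain \<tau> where perm: "\<tau> permutes {..<b}" and
      f: "\<And>x. f x = (if x \<in> ?R then if L x mod b = \<tau> (K x mod b) then 1 else -1 else 0)"
      unfolding K_def[symmetric] L_def[symmetric] by auto
    have fS: "f x = (if j = \<tau> i then 1 else -1)" if "i < b" "j < b" "x \<in> S i j" for i j x
      using f[of x] memS[of i j x] that by simp
    then have one: "(\<forall>x\<in>S i j. f x = 1) \<longleftrightarrow> j = \<tau> i" if "i < b" "j < b" for i j
    proof -
      obtain x where "x \<in> S i j" using ne by blast
      then show ?thesis using fS[OF that] by (cases "j = \<tau> i") fastforce+
    qed
    have "\<exists>!i. i < b \<and> (\<forall>x\<in>S i j. f x = 1)" if j: "j < b" for j
    proof -
      \<comment> \<open>Surjectivity of \<open>\<tau>\<close> gives a column for the row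
        \<open>j\<close>, injectivity its uniqueness.\<close>
      have "j \<in> \<tau> ` {..<b}" using permutes_image[OF perm] j by simp
      then show ?thesis using one[OF _ j] permutes_inj[OF perm] by (auto dest: injD)
    qed
    moreover have "\<exists>!j. j < b \<and> (\<forall>x\<in>S i j. f x = 1)" if i: "i < b" for i
      using one[OF i] permutes_in_image[OF perm, of i] i by (metis lessThan_iff)
    moreover have "f constant_on S i j" if "i < b" "j < b" for i j
      unfolding constant_on_def using fS[OF that] by blast
    ultimately show "f \<in> haar_family b ?R" unfolding fam using f by simp
  qed
qed

lemma haar_choice_codes:
  assumes "haar_choice b (m - 1) \<phi>"
  shows "\<exists>\<sigma>\<in>perm_systems. codes \<phi> \<sigma>"
proof -
  have "\<forall>i\<in>box_index b (m - 1). \<exists>\<tau>. \<tau> permutes {..<b} \<and>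
     (\<forall>x. \<phi> (badic_box b (m - 1) i) x = (if x \<in> badic_box b (m - 1) i
       then if (snd (cell x) div b ^ fst i) mod b = \<tau> ((fst (cell x) div b ^ (m - Suc (fst i))) mod b)
       then 1 else -1 else 0))"
  proof
    fix i assume i: "i \<in> box_index b (m - 1)"
    then have "\<phi> (badic_box b (m - 1) i) \<in> haar_family b (badic_box b (m - 1) i)"
      using assms by (simp add: haar_choice_def boxes_of_order_eq[OF b_ge_2])
    then show "\<exists>\<tau>. \<tau> permutes {..<b} \<and>
     (\<forall>x. \<phi> (badic_box b (m - 1) i) x = (if x \<in> badic_box b (m - 1) i
       then if (snd (cell x) div b ^ fst i) mod b = \<tau> ((fst (cell x) div b ^ (m - Suc (fst i))) mod b)
       then 1 else -1 else 0))"
      using haar_family_iff[of "fst i" "fst (snd i)" "snd (snd i)"] i by simp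
  qed
  then obtain f where f: "\<And>i. i \<in> box_index b (m - 1) \<Longrightarrow> f i permutes {..<b} \<and>
     (\<forall>x. \<phi> (badic_box b (m - 1) i) x = (if x \<in> badic_box b (m - 1) i
       then if (snd (cell x) div b ^ fst i) mod b = f i ((fst (cell x) div b ^ (m - Suc (fst i))) mod b)
       then 1 else -1 else 0))"
    by metis
  define \<sigma> where "\<sigma> = restrict f (box_index b (m - 1))"
  have "codes \<phi> \<sigma>"
    unfolding codes_def
  proof (intro ballI allI)
    fix i x assume i: "i \<in> box_index b (m - 1)"
    then have s: "fst i < m" using m_pos by (auto simp: box_index_def)
    \<comment> \<open>\<open>matches\<close> consults the permutation of the box of width b^(-s)
      around the cell; for \<open>x\<close> in box \<open>i\<close> and \<open>s = fst i\<close>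
      this is box \<open>i\<close> itself.\<close>
    have "(fst i, fst (cell x) div b ^ (m - fst i), snd (cell x) div b ^ Suc (fst i)) = i"
      if "x \<in> badic_box b (m - 1) i"
      using mem_badic_box_iff[OF s, of x "fst (snd i)" "snd (snd i)"] that by (simp add: prod_eq_iff)
    then show "\<phi> (badic_box b (m - 1) i) x =
       (if x \<in> badic_box b (m - 1) i then if matches \<sigma> (fst i) (cell x) then 1 else -1 else 0)"
      using f[OF i] i by (cases "x \<in> badic_box b (m - 1) i") (simp_all only: matches_def \<sigma>_def restrict_apply' if_True if_False)
  qed
  moreover have "\<sigma> \<in> perm_systems" using f by (auto simp: \<sigma>_def perm_systems_def)
  ultimately show ?thesis by blast
qed

lemma codes_exists:
  assumes \<sigma>: "\<sigma> \<in> perm_systems"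
  shows "\<exists>\<phi>. haar_choice b (m - 1) \<phi> \<and> codes \<phi> \<sigma>"
proof -
  let ?I = "box_index b (m - 1)" and ?B = "badic_box b (m - 1)"
  \<comment> \<open>The width exponent is recovered from \<open>R\<close> by inverting
    \<open>badic_box\<close>; only the values at boxes of area b^(1-m) matter.\<close>
  define \<phi> where "\<phi> R x = (if x \<in> R
    then if matches \<sigma> (fst (the_inv_into ?I ?B R)) (cell x) then 1 else -1 else 0 :: real)" for R x
  have inv: "the_inv_into ?I ?B (?B i) = i" if "i \<in> ?I" for i
    using the_inv_into_f_f[OF inj_on_badic_box[OF b_ge_2] that] .
  have codes: "codes \<phi> \<sigma>" unfolding codes_def \<phi>_def by (intro ballI allI) (simp only: inv)
  have "\<phi> (?B i) \<in> haar_family b (?B i)" if i: "i \<in> ?I" for i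
  proof -
    obtain s u v where suv: "i = (s, u, v)" by (cases i)
    have s: "s < m" using i m_pos by (auto simp: box_index_def suv)
    show ?thesis
      unfolding suv haar_family_iff[OF i[unfolded suv]]
    proof (intro exI conjI allI)
      show "\<sigma> (s, u, v) permutes {..<b}" using perm_systems_permutes[OF \<sigma>] i suv by blast
      fix x
      show "\<phi> (?B (s, u, v)) x = (if x \<in> ?B (s, u, v)
         then if (snd (cell x) div b ^ s) mod b = \<sigma> (s, u, v) ((fst (cell x) div b ^ (m - Suc s)) mod b)
         then 1 else -1 else 0)"
        unfolding codesD[OF codes i[unfolded suv]] using mem_badic_box_iff[OF s, of x u v]
        by (auto simp: matches_def simp del: power_Suc)
    qed
  qed
  then show ?thesis using codes unfolding haar_choice_def boxes_of_order_eq[OF b_ge_2] by blast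
qed

section \<open>The sum of the Haar functions and its maximum\<close>

lemma haar_sum_codes:
  assumes codes: "codes \<phi> \<sigma>" and x: "x \<in> unit_square"
  shows "haar_sum b (m - 1) \<phi> x = real m - 2 * real (card {s. s < m \<and> \<not> matches \<sigma> s (cell x)})"
proof -
  let ?I = "box_index b (m - 1)" and ?B = "badic_box b (m - 1)"
  \<comment> \<open>\<open>par s\<close> is the one box of width b^(-s) and area b^(1-m) around
    \<open>x\<close>; these \<open>m\<close> boxes carry all nonzero terms.\<close>
  define par where "par s = (s, fst (cell x) div b ^ (m - s), snd (cell x) div b ^ Suc s)" for s
  have x0: "0 \<le> fst x" "0 \<le> snd x" using x by (auto simp: unit_square_def)
  have par: "par s \<in> ?I" "x \<in> ?B (par s)" if "s < m" for s
    using parent_in_box_index[OF cell_in_grid[OF x] that] mem_badic_box_iff[OF that] x0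
    by (simp_all add: par_def)
  have out: "i \<in> par ` {..<m}" if "i \<in> ?I" "x \<in> ?B i" for i
  proof -
    have "fst i < m" using that m_pos by (auto simp: box_index_def)
    then have "i = par (fst i)"
      using mem_badic_box_iff[of "fst i" x "fst (snd i)" "snd (snd i)"] that
      by (simp add: par_def prod_eq_iff)
    then show ?thesis using \<open>fst i < m\<close> by blast
  qed
  have "haar_sum b (m - 1) \<phi> x = (\<Sum>i\<in>?I. \<phi> (?B i) x)"
    unfolding haar_sum_def boxes_of_order_eq[OF b_ge_2]
    by (subst sum.reindex[OF inj_on_badic_box[OF b_ge_2]]) simp
  also have "\<dots> = (\<Sum>i\<in>par ` {..<m}. \<phi> (?B i) x)"
    by (rule sum.mono_neutral_right) (use par out codesD[OF codes] in auto)
  also have "\<dots> = (\<Sum>s<m. \<phi> (?B (par s)) x)"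
    by (subst sum.reindex) (auto simp: inj_on_def par_def)
  \<comment> \<open>A relation that holds contributes 1; a failing one contributes -1 and so costs
    2.\<close>
  also have "\<dots> = (\<Sum>s<m. 1 - 2 * of_bool (\<not> matches \<sigma> s (cell x)))"
    using codesD[OF codes par(1)] par(2) by (intro sum.cong refl) (simp del: One_nat_def, simp add: par_def)
  also have "\<dots> = real m - 2 * (\<Sum>s<m. of_bool (\<not> matches \<sigma> s (cell x)))"
    by (simp add: sum_subtractf sum_distrib_left)
  also have "(\<Sum>s<m. of_bool (\<not> matches \<sigma> s (cell x)) :: real) =
      real (card {s. s < m \<and> \<not> matches \<sigma> s (cell x)})"
    by (simp add: sum_of_bool_eq Collect_conj_eq lessThan_def)
  finally show ?thesis .
qed

lemma haar_sum_le: "codes \<phi> \<sigma> \<Longrightarrow> x \<in> unit_square \<Longrightarrow> haar_sum b (m - 1) \<phi> x \<le> real m"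
  by (simp only: haar_sum_codes)

lemma haar_sum_eq_iff:
  assumes "codes \<phi> \<sigma>" "x \<in> unit_square"
  shows "haar_sum b (m - 1) \<phi> x = real m \<longleftrightarrow> cell x \<in> good_cells \<sigma>"
  using cell_in_grid[OF assms(2)] by (simp only: haar_sum_codes[OF assms]) (auto simp: good_cells_def)

text \<open>Any good cell would do; the witness is the corner of one with ordinate 0.\<close>

lemma haar_sum_max_attained:
  assumes "\<sigma> \<in> perm_systems" "codes \<phi> \<sigma>"
  shows "\<exists>x\<in>unit_square. haar_sum b (m - 1) \<phi> x = real m"
proof -
  obtain k where k: "(k, 0) \<in> good_cells \<sigma>"
    using good_cell_with_ordinate[OF assms(1), of 0] b_pos by auto
  then have "corner (k, 0) \<in> unit_square" by (auto intro: corner_in_unit_square simp: good_cells_def)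
  then show ?thesis using haar_sum_eq_iff[OF assms(2)] k cell_corner by metis
qed

lemma max_set_haar_sum:
  assumes "\<sigma> \<in> perm_systems" "codes \<phi> \<sigma>"
  shows "max_set (haar_sum b (m - 1) \<phi>) = corner ` good_cells \<sigma> + corner_square b m"
proof -
  have "good_cells \<sigma> \<subseteq> grid" by (auto simp: good_cells_def)
  \<comment> \<open>As \<open>m\<close> is an attained upper bound, the maximisers are the points of
    value \<open>m\<close>.\<close>
  moreover have "is_arg_max (haar_sum b (m - 1) \<phi>) (\<lambda>x. x \<in> unit_square) x \<longleftrightarrow>
      x \<in> unit_square \<and> haar_sum b (m - 1) \<phi> x = real m" for x
    using haar_sum_max_attained[OF assms] haar_sum_le[OF assms(2)]
    unfolding is_arg_max_linorder by (metis order_antisym)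
  ultimately show ?thesis
    using haar_sum_eq_iff[OF assms(2)] by (auto simp: max_set_def corner_plus_corner_square)
qed

end

theorem theorem10:
  fixes b m :: nat
  assumes "m \<ge> 1" and "b \<ge> 2"
  shows "(\<forall>\<phi>. haar_choice b (m - 1) \<phi> \<longrightarrow>
            (\<exists>x\<in>unit_square. haar_sum b (m - 1) \<phi> x = real m) \<and>
            (\<forall>x\<in>unit_square. haar_sum b (m - 1) \<phi> x \<le> real m)) \<and>
         (\<forall>\<phi>. haar_choice b (m - 1) \<phi> \<longrightarrow>
            (\<exists>P. is_standard_net b m P \<and>
                 max_set (haar_sum b (m - 1) \<phi>) = P + corner_square b m)) \<and>
         (\<forall>P. is_standard_net b m P \<longrightarrow>
            (\<exists>\<phi>. haar_choice b (m - 1) \<phi> \<and>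
                 max_set (haar_sum b (m - 1) \<phi>) = P + corner_square b m)) \<and>
         card {P. is_standard_net b m P} = fact b ^ (m * b ^ (m - 1))"
proof (intro conjI allI impI)
  interpret badic_grid b m using assms by unfold_locales
  fix \<phi> assume "haar_choice b (m - 1) \<phi>"
  then obtain \<sigma> where \<sigma>: "\<sigma> \<in> perm_systems" "codes \<phi> \<sigma>" using haar_choice_codes by blast
  show "\<exists>x\<in>unit_square. haar_sum b (m - 1) \<phi> x = real m"
    by (rule haar_sum_max_attained[OF \<sigma>])
  show "\<forall>x\<in>unit_square. haar_sum b (m - 1) \<phi> x \<le> real m"
    using haar_sum_le[OF \<sigma>(2)] by blast
  show "\<exists>P. is_standard_net b m P \<and> max_set (haar_sum b (m - 1) \<phi>) = P + corner_square b m"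
    using max_set_haar_sum[OF \<sigma>] grid_net_good_cells[OF \<sigma>(1)] is_standard_net_iff by blast
next
  interpret badic_grid b m using assms by unfold_locales
  fix P assume "is_standard_net b m P"
  then obtain D where D: "grid_net D" "P = corner ` D" using is_standard_net_iff by auto
  then obtain \<sigma> where \<sigma>: "\<sigma> \<in> perm_systems" "good_cells \<sigma> = D"
    using grid_net_is_good_cells by auto
  obtain \<phi> where "haar_choice b (m - 1) \<phi>" "codes \<phi> \<sigma>" using codes_exists[OF \<sigma>(1)] by auto
  then show "\<exists>\<phi>. haar_choice b (m - 1) \<phi> \<and> max_set (haar_sum b (m - 1) \<phi>) = P + corner_square b m"
    using max_set_haar_sum[OF \<sigma>(1)] D(2) \<sigma>(2) by (intro exI[of _ \<phi>]) simp
next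
  interpret badic_grid b m using assms by unfold_locales
  show "card {P. is_standard_net b m P} = fact b ^ (m * b ^ (m - 1))"
    by (rule card_standard_nets)
qed

end
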